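(* For any (possibly adaptive) algorithm $A$, if $A$ uses $k/4$ comparisons of any size (sets of any size between $2$ and $n$), then $A$ identifies the top-$k$ items with probability at most $2/3$. This holds even if $A$ is given the values $\{\theta_1,\dots,\theta_n\}$.
   Context: MNL model: $n$ items with positive scores $\theta_1\ge\cdots\ge\theta_k>\theta_{k+1}\ge\cdots\ge\theta_n$; the top-$k$ items are those with scores $\theta_1,\dots,\theta_k$. The algorithm sees the items only via labels given by a uniformly random permutation $\pi$ of $[n]$ (item with score $\theta_i$ has label $\pi_i$); it may know the multiset of score values but not which label carries which score. In each round it chooses (adaptively) a set $S$ of at least two items and observes one item $a\in S$ with probability $\theta_a/\sum_{j\in S}\theta_j$, independently of the past given $S$. Each round is one comparison. Success means outputting $\{\pi_1,\dots,\pi_k\}$; probability is over $\pi$, outcomes and the algorithm's randomness. *)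

theory Defs
  imports "HOL-Probability.Probability" "HOL-Combinatorics.Permutations"
begin

definition mnl_scores :: "nat \<Rightarrow> nat \<Rightarrow> (nat \<Rightarrow> real) \<Rightarrow> bool" where
  "mnl_scores n k \<theta> \<longleftrightarrow>
     1 \<le> k \<and> k < n \<and>
     (\<forall>i\<in>{1..n}. 0 < \<theta> i) \<and>
     (\<forall>i\<in>{1..n}. \<forall>j\<in>{1..n}. i \<le> j \<longrightarrow> \<theta> j \<le> \<theta> i) \<and>
     \<theta> (k + 1) < \<theta> k"

definition mnl_choice :: "(nat \<Rightarrow> real) \<Rightarrow> nat set \<Rightarrow> nat pmf" where
  "mnl_choice w S = embed_pmf (\<lambda>a. if a \<in> S then w a / (\<Sum>j\<in>S. w j) else 0)"

lemma pmf_mnl_choice: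
  assumes "finite S" "S \<noteq> {}" "\<And>j. j \<in> S \<Longrightarrow> 0 < w j"
  shows "pmf (mnl_choice w S) a = (if a \<in> S then w a / (\<Sum>j\<in>S. w j) else 0)"
  unfolding mnl_choice_def
proof (rule pmf_embed_pmf)
  have pos: "0 < (\<Sum>j\<in>S. w j)"
    using assms by (intro sum_pos) auto
  show nonneg: "0 \<le> (if a \<in> S then w a / (\<Sum>j\<in>S. w j) else 0)" for a
    using pos assms(3)[of a] by auto
  have "(\<integral>\<^sup>+ a. ennreal (if a \<in> S then w a / (\<Sum>j\<in>S. w j) else 0) \<partial>count_space UNIV)
      = (\<Sum>a\<in>S. ennreal (if a \<in> S then w a / (\<Sum>j\<in>S. w j) else 0))"
    by (intro nn_integral_count_space') (use assms(1) in auto)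
  also have "\<dots> = ennreal (\<Sum>a\<in>S. if a \<in> S then w a / (\<Sum>j\<in>S. w j) else 0)"
    using nonneg by (intro sum_ennreal) blast
  also have "(\<Sum>a\<in>S. if a \<in> S then w a / (\<Sum>j\<in>S. w j) else 0) = 1"
    using pos by (simp flip: sum_divide_distrib)
  finally show "(\<integral>\<^sup>+ a. ennreal (if a \<in> S then w a / (\<Sum>j\<in>S. w j) else 0)
      \<partial>count_space UNIV) = 1" by simp
qed

datatype action = Compare "nat set" | Output "nat set"

type_synonym history = "(nat set \<times> nat) list"

text \<open>
  A randomized adaptive algorithm is given by the conditional distribution of its next action
  given all sets compared so far and the observed winners, oldest round first. Since a history
  records the algorithm's own choices too, and there are only finitely many sets to compare,
  this also covers algorithms driven by a private random seed kept across rounds.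
\<close>
type_synonym algorithm = "history \<Rightarrow> action pmf"

definition uses_at_most :: "nat \<Rightarrow> nat \<Rightarrow> algorithm \<Rightarrow> bool" where
  "uses_at_most n m A \<longleftrightarrow>
     (\<forall>h S. Compare S \<in> set_pmf (A h) \<longrightarrow>
        length h < m \<and> S \<subseteq> {1..n} \<and> 2 \<le> card S)"

text \<open>
  The output of \<open>A\<close> continued from history \<open>h\<close>, where \<open>w\<close> gives the scores of the labels and
  at most \<open>m\<close> further comparisons are made. The result \<open>None\<close> (an attempt to exceed \<open>m\<close>) has
  probability 0 in \<open>run w A m []\<close> if \<open>uses_at_most n m A\<close>.
\<close>
primrec run :: "(nat \<Rightarrow> real) \<Rightarrow> algorithm \<Rightarrow> nat \<Rightarrow> history \<Rightarrow> nat set option pmf" where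
  run_0: "run w A 0 h =
     bind_pmf (A h) (\<lambda>x. case x of
        Output T \<Rightarrow> return_pmf (Some T)
      | Compare S \<Rightarrow> return_pmf None)"
| run_Suc: "run w A (Suc m) h =
     bind_pmf (A h) (\<lambda>x. case x of
        Output T \<Rightarrow> return_pmf (Some T)
      | Compare S \<Rightarrow> bind_pmf (mnl_choice w S) (\<lambda>a. run w A m (h @ [(S, a)])))"

text \<open>
  Item \<open>i\<close> carries the label \<open>\<pi> i\<close>, so the label \<open>a\<close> has score \<open>\<theta> (inv \<pi> a)\<close>.
\<close>
definition mnl_trial ::
  "nat \<Rightarrow> (nat \<Rightarrow> real) \<Rightarrow> algorithm \<Rightarrow> nat \<Rightarrow> ((nat \<Rightarrow> nat) \<times> nat set option) pmf" where
  "mnl_trial n \<theta> A m =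
     bind_pmf (pmf_of_set {\<pi>. \<pi> permutes {1..n}}) (\<lambda>\<pi>.
       map_pmf (Pair \<pi>) (run (\<lambda>a. \<theta> (inv \<pi> a)) A m []))"

definition success_prob :: "nat \<Rightarrow> nat \<Rightarrow> (nat \<Rightarrow> real) \<Rightarrow> algorithm \<Rightarrow> nat \<Rightarrow> real" where
  "success_prob n k \<theta> A m =
     measure_pmf.prob (mnl_trial n \<theta> A m) {(\<pi>, T). T = Some (\<pi> ` {1..k})}"

end

theory Submission imports Defs begin

text \<open>
  For \<open>1 \<le> i \<le> k\<close> let \<open>\<pi>\<^sub>i\<close> be \<open>\<pi>\<close> with the labels of the items \<open>i\<close> and \<open>k + 1\<close> exchanged. Runs
  under \<open>\<pi>\<close> and \<open>\<pi>\<^sub>i\<close> can be coupled to agree until item \<open>i\<close> wins a round in one of them. Each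
  round has one winner, so the probabilities of parting sum over \<open>i\<close> to at most \<open>2 m\<close>, on average
  over \<open>\<pi>\<close>. The answers demanded by the \<open>k + 1\<close> permutations \<open>\<pi>, \<pi>\<^sub>1, \<dots>, \<pi>\<^sub>k\<close> are distinct, hence
  a run under \<open>\<pi>\<close> gives one of them with probability at most 1 in total. As each \<open>\<pi>\<^sub>i\<close> is again
  uniform, \<open>k + 1\<close> times the success probability is at most \<open>1 + 2 m\<close>, which is at most
  \<open>2 (k + 1) / 3\<close> for \<open>m \<le> k / 4\<close>, the case \<open>k = 1\<close> using \<open>m = 0\<close>.
\<close>

section \<open>Total variation distance and the coupling of a single draw\<close>

text \<open>Adding either excess to the matching mass function yields the pointwise maximum of the
  two. Both mass functions have total mass 1, which is finite and can be cancelled.\<close>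

lemma nn_integral_pmf_excess_sym:
  fixes p q :: "'a pmf"
  shows "(\<integral>\<^sup>+a. ennreal (pmf q a - pmf p a) \<partial>count_space UNIV)
       = (\<integral>\<^sup>+a. ennreal (pmf p a - pmf q a) \<partial>count_space UNIV)"
proof -
  have one: "(\<integral>\<^sup>+a. ennreal (pmf r a) \<partial>count_space UNIV) = 1" for r :: "'a pmf"
    by (simp add: nn_integral_pmf)
  have pt: "ennreal (pmf p a) + ennreal (pmf q a - pmf p a)
          = ennreal (pmf q a) + ennreal (pmf p a - pmf q a)" for a
    by (cases "pmf p a \<le> pmf q a") (simp_all add: ennreal_neg flip: ennreal_plus)
  have "1 + (\<integral>\<^sup>+a. ennreal (pmf q a - pmf p a) \<partial>count_space UNIV)
      = (\<integral>\<^sup>+a. ennreal (pmf p a) + ennreal (pmf q a - pmf p a) \<partial>count_space UNIV)"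
    by (subst nn_integral_add) (simp_all add: one)
  also have "\<dots> = 1 + (\<integral>\<^sup>+a. ennreal (pmf p a - pmf q a) \<partial>count_space UNIV)"
    unfolding pt by (subst nn_integral_add) (simp_all add: one)
  finally show ?thesis
    by (simp add: ennreal_add_left_cancel)
qed

text \<open>
  Under either domination hypothesis the total variation distance of \<open>p\<close> and \<open>q\<close> is carried by
  a single point.
\<close>
lemma nn_integral_pmf_excess_le:
  fixes p q :: "'a pmf"
  assumes "(\<forall>a. a \<noteq> y \<longrightarrow> pmf q a \<le> pmf p a) \<or> (\<forall>a. a \<noteq> x \<longrightarrow> pmf p a \<le> pmf q a)"
  shows "(\<integral>\<^sup>+a. ennreal (pmf q a - pmf p a) \<partial>count_space UNIV)
       \<le> ennreal (pmf p x) + ennreal (pmf q y)"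
proof -
  have single: "(\<integral>\<^sup>+a. ennreal (pmf s a - pmf r a) \<partial>count_space UNIV) \<le> ennreal (pmf s z)"
    if "\<forall>a. a \<noteq> z \<longrightarrow> pmf s a \<le> pmf r a" for r s :: "'a pmf" and z
  proof -
    have "(\<integral>\<^sup>+a. ennreal (pmf s a - pmf r a) \<partial>count_space UNIV)
        \<le> (\<integral>\<^sup>+a. ennreal (pmf s z) * indicator {z} a \<partial>count_space UNIV)"
      using that by (intro nn_integral_mono)
        (auto split: split_indicator simp: ennreal_neg intro!: ennreal_leI)
    also have "\<dots> = ennreal (pmf s z)"
      by (simp add: nn_integral_cmult_indicator)
    finally show ?thesis .
  qed
  from assms show ?thesis
  proof
    assume "\<forall>a. a \<noteq> y \<longrightarrow> pmf q a \<le> pmf p a"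
    from single[OF this] show ?thesis by (simp add: add_increasing)
  next
    assume "\<forall>a. a \<noteq> x \<longrightarrow> pmf p a \<le> pmf q a"
    \<comment> \<open>Here \<open>single\<close> bounds the excess of \<open>p\<close> over
      \<open>q\<close>; symmetry turns it into the excess of \<open>q\<close> over
      \<open>p\<close>.\<close>
    from single[OF this] show ?thesis
      unfolding nn_integral_pmf_excess_sym[of q p] by (simp add: add_increasing2)
  qed
qed

text \<open>One round of the coupling: \<open>F\<close> and \<open>G\<close> stand for the answer
  probabilities of the two continued runs, \<open>U\<close> and \<open>V\<close> for the cost of
  parting later. On the mass common to \<open>p\<close> and \<open>q\<close> the hypothesis
  \<open>le\<close> applies. On the excess of \<open>q\<close> the bound \<open>G a \<le> 1\<close>
  is used, and the excess is paid for by the chance that \<open>x\<close> is drawn from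
  \<open>p\<close> or \<open>y\<close> from \<open>q\<close>.\<close>

lemma nn_integral_pmf_coupling_le:
  fixes p q :: "'a pmf" and F G U V :: "'a \<Rightarrow> ennreal"
  assumes bound: "\<And>a. G a \<le> 1" and le: "\<And>a. G a \<le> F a + U a + V a"
    and dom: "(\<forall>a. a \<noteq> y \<longrightarrow> pmf q a \<le> pmf p a) \<or> (\<forall>a. a \<noteq> x \<longrightarrow> pmf p a \<le> pmf q a)"
  shows "(\<integral>\<^sup>+a. G a \<partial>q) \<le> (\<integral>\<^sup>+a. F a \<partial>p)
      + (\<integral>\<^sup>+a. indicator {x} a + U a \<partial>p) + (\<integral>\<^sup>+a. indicator {y} a + V a \<partial>q)"
proof -
  let ?C = "count_space UNIV :: 'a measure"
  have pt: "ennreal (pmf q a) * G a \<le> ennreal (pmf p a) * F a + ennreal (pmf p a) * U a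
      + ennreal (pmf q a) * V a + ennreal (pmf q a - pmf p a)" for a
  proof (cases "pmf q a \<le> pmf p a")
    case True
    have "ennreal (pmf q a) * G a \<le> ennreal (pmf q a) * (F a + U a + V a)"
      by (intro mult_left_mono le) simp
    also have "\<dots> = ennreal (pmf q a) * F a + ennreal (pmf q a) * U a + ennreal (pmf q a) * V a"
      by (simp add: distrib_left)
    also have "\<dots> \<le> ennreal (pmf p a) * F a + ennreal (pmf p a) * U a + ennreal (pmf q a) * V a"
      using True by (intro add_mono mult_right_mono ennreal_leI) auto
    finally show ?thesis by (simp add: add_increasing2)
  next
    case False
    have "ennreal (pmf q a) * G a = ennreal (pmf p a) * G a + ennreal (pmf q a - pmf p a) * G a"
      using False by (simp flip: distrib_right ennreal_plus)
    also have "\<dots> \<le> ennreal (pmf p a) * (F a + U a + V a) + ennreal (pmf q a - pmf p a) * 1"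
      by (intro add_mono mult_left_mono le bound) simp_all
    also have "\<dots> = ennreal (pmf p a) * F a + ennreal (pmf p a) * U a + ennreal (pmf p a) * V a
        + ennreal (pmf q a - pmf p a)"
      by (simp add: distrib_left)
    also have "\<dots> \<le> ennreal (pmf p a) * F a + ennreal (pmf p a) * U a + ennreal (pmf q a) * V a
        + ennreal (pmf q a - pmf p a)"
      using False by (intro add_mono mult_right_mono ennreal_leI) auto
    finally show ?thesis .
  qed
  have "(\<integral>\<^sup>+a. G a \<partial>q) = (\<integral>\<^sup>+a. ennreal (pmf q a) * G a \<partial>?C)"
    by (rule nn_integral_measure_pmf)
  also have "\<dots> \<le> (\<integral>\<^sup>+a. ennreal (pmf p a) * F a + ennreal (pmf p a) * U a
      + ennreal (pmf q a) * V a + ennreal (pmf q a - pmf p a) \<partial>?C)"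
    by (intro nn_integral_mono pt)
  also have "\<dots> = (\<integral>\<^sup>+a. F a \<partial>p) + (\<integral>\<^sup>+a. U a \<partial>p) + (\<integral>\<^sup>+a. V a \<partial>q)
      + (\<integral>\<^sup>+a. ennreal (pmf q a - pmf p a) \<partial>?C)"
    by (simp add: nn_integral_add nn_integral_measure_pmf)
  also have "\<dots> \<le> (\<integral>\<^sup>+a. F a \<partial>p) + (\<integral>\<^sup>+a. U a \<partial>p) + (\<integral>\<^sup>+a. V a \<partial>q)
      + (ennreal (pmf p x) + ennreal (pmf q y))"
    by (intro add_left_mono nn_integral_pmf_excess_le dom)
  also have "\<dots> = (\<integral>\<^sup>+a. F a \<partial>p)
      + (\<integral>\<^sup>+a. indicator {x} a + U a \<partial>p) + (\<integral>\<^sup>+a. indicator {y} a + V a \<partial>q)"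
    by (simp add: nn_integral_add emeasure_pmf_single ac_simps)
  finally show ?thesis .
qed

section \<open>Coupling of two runs of the algorithm\<close>

text \<open>The total score of \<open>S\<close> decides which alternative holds. If it does not drop
  from \<open>w\<close> to \<open>w'\<close>, every label except \<open>y\<close> gets a numerator
  no larger over a denominator no smaller; otherwise the same argument with the roles exchanged
  spares only \<open>x\<close>.\<close>

lemma pmf_mnl_choice_dominated:
  assumes S: "finite S" "S \<noteq> {}"
    and pos: "\<And>a. a \<in> S \<Longrightarrow> 0 < w a" "\<And>a. a \<in> S \<Longrightarrow> 0 < w' a"
    and le: "\<And>a. a \<noteq> y \<Longrightarrow> w' a \<le> w a" "\<And>a. a \<noteq> x \<Longrightarrow> w a \<le> w' a"
  shows "(\<forall>a. a \<noteq> y \<longrightarrow> pmf (mnl_choice w' S) a \<le> pmf (mnl_choice w S) a) \<or>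
         (\<forall>a. a \<noteq> x \<longrightarrow> pmf (mnl_choice w S) a \<le> pmf (mnl_choice w' S) a)"
proof -
  have s: "0 < sum w S" "0 < sum w' S"
    using S pos by (auto intro: sum_pos)
  show ?thesis
  proof (cases "sum w S \<le> sum w' S")
    case True
    have "w' a / sum w' S \<le> w a / sum w S" if "a \<in> S" "a \<noteq> y" for a
      using that True s pos le by (intro frac_le) (auto intro: less_imp_le)
    then show ?thesis
      using S pos by (auto simp: pmf_mnl_choice)
  next
    case False
    have "w a / sum w S \<le> w' a / sum w' S" if "a \<in> S" "a \<noteq> x" for a
      using that False s pos le by (intro frac_le) (auto intro: less_imp_le)
    then show ?thesis
      using S pos by (auto simp: pmf_mnl_choice)
  qed
qed

text \<open>The recursion mirrors \<open>run\<close> instead of counting wins in a random history,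
  so that both unfold together in an induction on \<open>m\<close>. Values in \<open>ennreal\<close>
  avoid integrability conditions.\<close>

primrec expected_wins :: "(nat \<Rightarrow> real) \<Rightarrow> algorithm \<Rightarrow> nat \<Rightarrow> history \<Rightarrow> nat \<Rightarrow> ennreal" where
  "expected_wins w A 0 h x = 0"
| "expected_wins w A (Suc m) h x =
     (\<integral>\<^sup>+act. (case act of
        Output T \<Rightarrow> 0
      | Compare S \<Rightarrow> \<integral>\<^sup>+a. indicator {x} a + expected_wins w A m (h @ [(S, a)]) x
          \<partial>mnl_choice w S) \<partial>A h)"

text \<open>A round has a single winner, so it adds at most 1 to the total over all of
  \<open>X\<close>.\<close>

lemma sum_expected_wins_le:
  assumes "finite X"
  shows "(\<Sum>x\<in>X. expected_wins w A m h x) \<le> of_nat m"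
proof (induction m arbitrary: h)
  case (Suc m)
  have winner: "(\<Sum>x\<in>X. indicator {x} a) \<le> (1 :: ennreal)" for a
    using assms by (cases "a \<in> X") (simp_all add: indicator_def)
  have "(\<Sum>x\<in>X. expected_wins w A (Suc m) h x) =
     (\<integral>\<^sup>+act. (\<Sum>x\<in>X. case act of
        Output T \<Rightarrow> 0
      | Compare S \<Rightarrow> \<integral>\<^sup>+a. indicator {x} a + expected_wins w A m (h @ [(S, a)]) x
          \<partial>mnl_choice w S) \<partial>A h)"
    by (simp add: nn_integral_sum)
  also have "\<dots> \<le> (\<integral>\<^sup>+act. of_nat (Suc m) \<partial>A h)"
  proof (intro nn_integral_mono)
    fix act
    have "(\<Sum>x\<in>X. \<integral>\<^sup>+a. indicator {x} a + expected_wins w A m (h @ [(S, a)]) x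
        \<partial>mnl_choice w S) \<le> of_nat (Suc m)" for S
    proof -
      have "(\<Sum>x\<in>X. \<integral>\<^sup>+a. indicator {x} a + expected_wins w A m (h @ [(S, a)]) x
            \<partial>mnl_choice w S)
          = (\<integral>\<^sup>+a. (\<Sum>x\<in>X. indicator {x} a) + (\<Sum>x\<in>X. expected_wins w A m (h @ [(S, a)]) x)
            \<partial>mnl_choice w S)"
        by (simp add: sum.distrib flip: nn_integral_sum)
      also have "\<dots> \<le> (\<integral>\<^sup>+a. 1 + of_nat m \<partial>mnl_choice w S)"
        by (intro nn_integral_mono add_mono winner Suc.IH)
      finally show ?thesis by simp
    qed
    then show "(\<Sum>x\<in>X. case act of
        Output T \<Rightarrow> 0
      | Compare S \<Rightarrow> \<integral>\<^sup>+a. indicator {x} a + expected_wins w A m (h @ [(S, a)]) x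
          \<partial>mnl_choice w S) \<le> of_nat (Suc m)"
      by (cases act) auto
  qed
  finally show ?case by simp
qed simp

text \<open>
  The two runs can be coupled so that they part only in a round that \<open>x\<close> wins under \<open>w\<close> or
  \<open>y\<close> wins under \<open>w'\<close>.
\<close>
lemma pmf_run_le:
  assumes A: "uses_at_most n M A"
    and pos: "\<And>a. a \<in> {1..n} \<Longrightarrow> 0 < w a" "\<And>a. a \<in> {1..n} \<Longrightarrow> 0 < w' a"
    and le: "\<And>a. a \<noteq> y \<Longrightarrow> w' a \<le> w a" "\<And>a. a \<noteq> x \<Longrightarrow> w a \<le> w' a"
  shows "ennreal (pmf (run w' A m h) (Some T)) \<le>
    ennreal (pmf (run w A m h) (Some T)) + expected_wins w A m h x + expected_wins w' A m h y"
\<comment> \<open>With no rounds left \<open>run\<close> ignores the scores, so the base case is an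
  equality.\<close>
proof (induction m arbitrary: h)
  case (Suc m)
  let ?W = "\<lambda>v z act. case act of
        Output T \<Rightarrow> 0
      | Compare S \<Rightarrow> \<integral>\<^sup>+a. indicator {z} a + expected_wins v A m (h @ [(S, a)]) z
          \<partial>mnl_choice v S"
  let ?R = "\<lambda>v act. case act of
        Output U \<Rightarrow> return_pmf (Some U)
      | Compare S \<Rightarrow> bind_pmf (mnl_choice v S) (\<lambda>a. run v A m (h @ [(S, a)]))"
  \<comment> \<open>Only actions in the support of \<open>A h\<close> are known to compare valid
    sets, so this bound is integrated almost everywhere below.\<close>
  have step: "ennreal (pmf (?R w' act) (Some T)) \<le>
      ennreal (pmf (?R w act) (Some T)) + ?W w x act + ?W w' y act"
    if act: "act \<in> set_pmf (A h)" for act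
  proof (cases act)
    case (Compare S)
    then have S: "S \<subseteq> {1..n}" "2 \<le> card S"
      using A act by (auto simp: uses_at_most_def)
    then have fin: "finite S" "S \<noteq> {}"
      by (auto intro: finite_subset)
    have "(\<integral>\<^sup>+a. ennreal (pmf (run w' A m (h @ [(S, a)])) (Some T)) \<partial>mnl_choice w' S)
        \<le> (\<integral>\<^sup>+a. ennreal (pmf (run w A m (h @ [(S, a)])) (Some T)) \<partial>mnl_choice w S)
          + ?W w x (Compare S) + ?W w' y (Compare S)"
      unfolding action.case
      using S fin pos le
      by (intro nn_integral_pmf_coupling_le Suc.IH pmf_mnl_choice_dominated)
        (auto simp: pmf_le_1)
    then show ?thesis
      using Compare by (simp add: ennreal_pmf_bind)
  qed simp
  have "ennreal (pmf (run w' A (Suc m) h) (Some T))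
      = (\<integral>\<^sup>+act. ennreal (pmf (?R w' act) (Some T)) \<partial>A h)"
    by (simp only: run_Suc ennreal_pmf_bind)
  also have "\<dots> \<le> (\<integral>\<^sup>+act. ennreal (pmf (?R w act) (Some T)) + ?W w x act + ?W w' y act \<partial>A h)"
    by (intro nn_integral_mono_AE) (use step in \<open>auto simp: AE_measure_pmf_iff\<close>)
  also have "\<dots> = ennreal (pmf (run w A (Suc m) h) (Some T))
      + expected_wins w A (Suc m) h x + expected_wins w' A (Suc m) h y"
    by (simp only: run_Suc ennreal_pmf_bind expected_wins.simps)
      (simp add: nn_integral_add)
  finally show ?case .
qed simp

section \<open>Averaging over the permutations\<close>

lemma success_prob_eq:
  "success_prob n k \<theta> A m =
     (\<Sum>\<pi> | \<pi> permutes {1..n}. pmf (run (\<lambda>a. \<theta> (inv \<pi> a)) A m []) (Some (\<pi> ` {1..k}))) / fact n"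
proof -
  let ?P = "{\<pi>. \<pi> permutes {1..n}}"
  have P: "?P \<noteq> {}" "finite ?P" "card ?P = fact n"
    using permutes_id[of "{1..n}"] by (blast, simp_all add: finite_permutations card_permutations)
  have event: "Pair \<pi> -` {(\<pi>, T). T = Some (\<pi> ` {1..k})} = {Some (\<pi> ` {1..k})}"
    for \<pi> :: "nat \<Rightarrow> nat"
    by auto
  have "success_prob n k \<theta> A m = measure_pmf.expectation (pmf_of_set ?P)
      (\<lambda>\<pi>. pmf (run (\<lambda>a. \<theta> (inv \<pi> a)) A m []) (Some (\<pi> ` {1..k})))"
    unfolding success_prob_def mnl_trial_def measure_pmf_bind
    by (subst measure_pmf.measure_bind[where N = "count_space UNIV"])
      (auto simp: event measure_pmf_single measure_map_pmf measure_pmf_in_subprob_space)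
  then show ?thesis
    using P by (simp add: integral_pmf_of_set)
qed

text \<open>The index can be read off the image: \<open>i\<close> is the only element of
  \<open>{1..Suc k}\<close> missing from it, also for \<open>i = Suc k\<close>, where the
  transposition is the identity.\<close>

lemma image_transpose_inj_on:
  "inj_on (\<lambda>i. Transposition.transpose i (Suc k) ` {1..k}) {1..Suc k}"
proof (rule inj_on_inverseI)
  fix i assume "i \<in> {1..Suc k}"
  then have "{1..Suc k} - Transposition.transpose i (Suc k) ` {1..k} = {i}"
    by (auto simp: Transposition.transpose_def image_iff)
  then show "the_elem ({1..Suc k} - Transposition.transpose i (Suc k) ` {1..k}) = i"
    by simp
qed

theorem theorem7:
  fixes n k m :: nat and \<theta> :: "nat \<Rightarrow> real" and A :: algorithm
  assumes "mnl_scores n k \<theta>"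
    and "real m \<le> real k / 4"
    and "uses_at_most n m A"
  shows "success_prob n k \<theta> A m \<le> 2 / 3"
proof -
  let ?P = "{\<pi>. \<pi> permutes {1..n}}"
  let ?w = "\<lambda>\<pi> a. \<theta> (inv \<pi> a)"
  let ?\<tau> = "\<lambda>i. Transposition.transpose i (Suc k)"
  define G where "G \<pi> = pmf (run (?w \<pi>) A m []) (Some (\<pi> ` {1..k}))" for \<pi>
  \<comment> \<open>The run is under \<open>\<pi>\<close>, but the answer is the one that is correct
    for \<open>\<pi> \<circ> ?\<tau> i\<close>.\<close>
  define H where "H \<pi> i = pmf (run (?w \<pi>) A m []) (Some ((\<pi> \<circ> ?\<tau> i) ` {1..k}))" for \<pi> i
  define W where "W \<pi> i = expected_wins (?w \<pi>) A m [] (\<pi> i)" for \<pi> i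
  have kn: "1 \<le> k" "k < n" and \<theta>pos: "\<And>i. i \<in> {1..n} \<Longrightarrow> 0 < \<theta> i"
    and \<theta>mono: "\<And>i j. 1 \<le> i \<Longrightarrow> i \<le> j \<Longrightarrow> j \<le> n \<Longrightarrow> \<theta> j \<le> \<theta> i"
    using assms(1) by (auto simp: mnl_scores_def)
  have P: "finite ?P" "card ?P = fact n"
    by (auto simp: finite_permutations card_permutations)
  have bij: "bij_betw (\<lambda>\<pi>. \<pi> \<circ> ?\<tau> i) ?P ?P" if "i \<in> {1..Suc k}" for i
  proof -
    have "?\<tau> i permutes {1..n}"
      using that kn by (intro permutes_swap_id) auto
    then have "(\<lambda>\<pi>. \<pi> \<circ> ?\<tau> i) ` ?P \<subseteq> ?P"
      by (auto intro: permutes_compose)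
    then show ?thesis
      by (intro bij_betw_byWitness[where f' = "\<lambda>\<pi>. \<pi> \<circ> ?\<tau> i"]) (auto simp: comp_assoc)
  qed
  have shift: "(\<Sum>\<pi>\<in>?P. f (\<pi> \<circ> ?\<tau> i)) = sum f ?P" if "i \<in> {1..Suc k}"
    for f :: "(nat \<Rightarrow> nat) \<Rightarrow> 'c::comm_monoid_add" and i
    by (rule sum.reindex_bij_betw[OF bij[OF that]])
  have swap: "ennreal (G (\<pi> \<circ> ?\<tau> i)) \<le> ennreal (H \<pi> i) + W \<pi> i + W (\<pi> \<circ> ?\<tau> i) i"
    if \<pi>: "\<pi> \<in> ?P" and i: "i \<in> {1..k}" for \<pi> i
  proof -
    have bij\<pi>: "bij \<pi>"
      using \<pi> by (auto intro: permutes_bij)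
    have inv: "inv (\<pi> \<circ> ?\<tau> i) = ?\<tau> i \<circ> inv \<pi>"
      using bij\<pi> by (subst o_inv_distrib) auto
    have inP: "\<pi> \<circ> ?\<tau> i \<in> ?P"
      using bij_betwE[OF bij[of i]] \<pi> i by auto
    have pos: "0 < ?w \<rho> a" if "\<rho> \<in> ?P" "a \<in> {1..n}" for \<rho> a
      using that \<theta>pos permutes_in_image[OF permutes_inv, of \<rho> "{1..n}" a] by auto
    have inv_eq: "inv \<pi> a = j \<longleftrightarrow> a = \<pi> j" for a j
      using bij\<pi> by (metis bij_inv_eq_iff)
    have mono: "\<theta> (Suc k) \<le> \<theta> i"
      using i kn by (intro \<theta>mono) auto
    \<comment> \<open>Passing from \<open>\<pi>\<close> to \<open>\<pi> \<circ> ?\<tau> i\<close>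
      can lower only the score of label \<open>\<pi> i\<close> and raise only that of
      \<open>\<pi> (Suc k)\<close>. The latter is the label of item \<open>i\<close> after the
      exchange, so both win terms are instances of \<open>W\<close> at \<open>i\<close>.\<close>
    have "ennreal (pmf (run (?w (\<pi> \<circ> ?\<tau> i)) A m []) (Some T)) \<le>
        ennreal (pmf (run (?w \<pi>) A m []) (Some T)) + expected_wins (?w \<pi>) A m [] (\<pi> i)
        + expected_wins (?w (\<pi> \<circ> ?\<tau> i)) A m [] (\<pi> (Suc k))" for T
    proof (rule pmf_run_le[OF assms(3)])
      show "?w (\<pi> \<circ> ?\<tau> i) a \<le> ?w \<pi> a" if "a \<noteq> \<pi> (Suc k)" for a
        using that mono inv_eq[of a "Suc k"] by (auto simp: inv Transposition.transpose_def)
      show "?w \<pi> a \<le> ?w (\<pi> \<circ> ?\<tau> i) a" if "a \<noteq> \<pi> i" for a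
        using that mono inv_eq[of a i] by (auto simp: inv Transposition.transpose_def)
    qed (use pos[OF \<pi>] pos[OF inP] in auto)
    then show ?thesis
      by (simp add: G_def H_def W_def)
  qed
  have sum_H: "(\<Sum>i\<in>{1..Suc k}. H \<pi> i) \<le> 1" if \<pi>: "\<pi> \<in> ?P" for \<pi>
  proof -
    have "inj \<pi>"
      using \<pi> by (auto intro: permutes_inj)
    then have inj: "inj_on (\<lambda>i. Some ((\<pi> \<circ> ?\<tau> i) ` {1..k})) {1..Suc k}"
    proof (intro inj_onI)
      fix i j assume ij: "i \<in> {1..Suc k}" "j \<in> {1..Suc k}"
        and "Some ((\<pi> \<circ> ?\<tau> i) ` {1..k}) = Some ((\<pi> \<circ> ?\<tau> j) ` {1..k})"
      then have "\<pi> ` ?\<tau> i ` {1..k} = \<pi> ` ?\<tau> j ` {1..k}"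
        by (simp only: image_comp option.inject)
      then have "?\<tau> i ` {1..k} = ?\<tau> j ` {1..k}"
        by (rule iffD1[OF inj_image_eq_iff[OF \<open>inj \<pi>\<close>]])
      then show "i = j"
        using ij by (rule inj_onD[OF image_transpose_inj_on])
    qed
    have "(\<Sum>i\<in>{1..Suc k}. H \<pi> i)
        = sum (pmf (run (?w \<pi>) A m [])) ((\<lambda>i. Some ((\<pi> \<circ> ?\<tau> i) ` {1..k})) ` {1..Suc k})"
      unfolding H_def by (subst sum.reindex[OF inj]) (simp only: o_def)
    also have "\<dots> \<le> 1"
      by (simp add: measure_pmf.prob_le_1 flip: measure_measure_pmf_finite)
    finally show ?thesis .
  qed
  have sum_W: "(\<Sum>i\<in>{1..k}. W \<pi> i) \<le> of_nat m" if \<pi>: "\<pi> \<in> ?P" for \<pi>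
  proof -
    have "inj_on \<pi> {1..k}"
      using \<pi> by (auto intro: permutes_inj_on)
    then have "(\<Sum>i\<in>{1..k}. W \<pi> i) = sum (expected_wins (?w \<pi>) A m []) (\<pi> ` {1..k})"
      by (simp add: W_def sum.reindex)
    also have "\<dots> \<le> of_nat m"
      by (rule sum_expected_wins_le) simp
    finally show ?thesis .
  qed
  have H_nonneg: "0 \<le> H \<pi> i" for \<pi> i
    by (simp add: H_def)
  have G_last: "G (\<pi> \<circ> ?\<tau> (Suc k)) = H \<pi> (Suc k)" for \<pi>
    by (simp add: G_def H_def)
  \<comment> \<open>For each \<open>i\<close> the map
    \<open>\<pi> \<mapsto> \<pi> \<circ> ?\<tau> i\<close> permutes \<open>?P\<close>, so each of
    the \<open>Suc k\<close> inner sums equals \<open>sum G ?P\<close>.\<close>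
  have "ennreal (real (Suc k) * sum G ?P) = (\<Sum>i\<in>{1..Suc k}. \<Sum>\<pi>\<in>?P. ennreal (G (\<pi> \<circ> ?\<tau> i)))"
  proof -
    have "real (Suc k) * sum G ?P = (\<Sum>i\<in>{1..Suc k}. \<Sum>\<pi>\<in>?P. G (\<pi> \<circ> ?\<tau> i))"
      by (simp only: shift sum_constant card_atLeastAtMost cong: sum.cong) simp
    then show ?thesis
      by (simp add: G_def sum_nonneg)
  qed
  also have "\<dots> = (\<Sum>\<pi>\<in>?P. \<Sum>i\<in>{1..Suc k}. ennreal (G (\<pi> \<circ> ?\<tau> i)))"
    by (rule sum.swap)
  also have "\<dots> \<le> (\<Sum>\<pi>\<in>?P. (\<Sum>i\<in>{1..Suc k}. ennreal (H \<pi> i))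
      + (\<Sum>i\<in>{1..k}. W \<pi> i) + (\<Sum>i\<in>{1..k}. W (\<pi> \<circ> ?\<tau> i) i))"
  proof (rule sum_mono)
    have last: "sum f {1..Suc k} = sum f {1..k} + f (Suc k)" for f :: "nat \<Rightarrow> ennreal"
      by simp
    fix \<pi> assume \<pi>: "\<pi> \<in> ?P"
    \<comment> \<open>The index \<open>Suc k\<close> exchanges nothing, so its term is
      \<open>H \<pi> (Suc k)\<close> and has no parting cost.\<close>
    have "(\<Sum>i\<in>{1..k}. ennreal (G (\<pi> \<circ> ?\<tau> i)))
        \<le> (\<Sum>i\<in>{1..k}. ennreal (H \<pi> i) + W \<pi> i + W (\<pi> \<circ> ?\<tau> i) i)"
      by (intro sum_mono swap \<pi>)
    from add_right_mono[OF this, of "ennreal (H \<pi> (Suc k))"] show "(\<Sum>i\<in>{1..Suc k}. ennreal (G (\<pi> \<circ> ?\<tau> i))) \<le> (\<Sum>i\<in>{1..Suc k}. ennreal (H \<pi> i))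
      + (\<Sum>i\<in>{1..k}. W \<pi> i) + (\<Sum>i\<in>{1..k}. W (\<pi> \<circ> ?\<tau> i) i)"
      by (simp only: last G_last sum.distrib ac_simps)
  qed
  also have "\<dots> = (\<Sum>\<pi>\<in>?P. ennreal (\<Sum>i\<in>{1..Suc k}. H \<pi> i))
      + (\<Sum>\<pi>\<in>?P. \<Sum>i\<in>{1..k}. W \<pi> i) + (\<Sum>i\<in>{1..k}. \<Sum>\<pi>\<in>?P. W (\<pi> \<circ> ?\<tau> i) i)"
    by (subst (2) sum.swap) (simp only: sum.distrib sum_ennreal H_nonneg)
  \<comment> \<open>For a single \<open>\<pi>\<close> these wins belong to \<open>k\<close>
    different runs and \<open>sum_W\<close> does not apply. After summation over \<open>?P\<close>
    they can be reindexed to wins under one permutation.\<close>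
  also have "(\<Sum>i\<in>{1..k}. \<Sum>\<pi>\<in>?P. W (\<pi> \<circ> ?\<tau> i) i) = (\<Sum>i\<in>{1..k}. \<Sum>\<pi>\<in>?P. W \<pi> i)"
    using shift[of _ "\<lambda>\<pi>. W \<pi> i" for i] by - (rule sum.cong[OF refl], simp)
  also have "\<dots> = (\<Sum>\<pi>\<in>?P. \<Sum>i\<in>{1..k}. W \<pi> i)"
    by (rule sum.swap)
  also have "(\<Sum>\<pi>\<in>?P. ennreal (\<Sum>i\<in>{1..Suc k}. H \<pi> i))
      + (\<Sum>\<pi>\<in>?P. \<Sum>i\<in>{1..k}. W \<pi> i) + (\<Sum>\<pi>\<in>?P. \<Sum>i\<in>{1..k}. W \<pi> i)
      \<le> (\<Sum>\<pi>\<in>?P. ennreal 1) + (\<Sum>\<pi>\<in>?P. of_nat m) + (\<Sum>\<pi>\<in>?P. of_nat m)"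
    by (intro add_mono sum_mono sum_H sum_W ennreal_leI)
  also have "\<dots> = ennreal ((1 + 2 * real m) * fact n)"
    using P by (simp add: ennreal_of_nat_eq_real_of_nat algebra_simps flip: ennreal_mult' ennreal_plus)
  finally have "real (Suc k) * sum G ?P \<le> (1 + 2 * real m) * fact n"
    by (simp add: ennreal_le_iff)
  then have "real (Suc k) * success_prob n k \<theta> A m \<le> 1 + 2 * real m"
    by (simp add: success_prob_eq G_def field_simps)
  \<comment> \<open>Cleared of denominators this is \<open>6 * m + 1 \<le> 2 * k\<close>. It follows
    from \<open>4 * m \<le> k\<close> if \<open>1 \<le> m\<close>, and from \<open>1 \<le> k\<close>
    if \<open>m = 0\<close>.\<close>
  also have "\<dots> \<le> real (Suc k) * (2 / 3)"
    using assms(2) kn by (cases "m = 0") (simp_all add: field_simps)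
  finally show ?thesis
    by (rule mult_left_le_imp_le) simp
qed

end
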